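(* (Limit $q$-Hermite case.) Let $0<|q|<1$ and let $\delta$ be a nonzero complex number. Then for $z\ne0$ for which the denominator on the right is nonzero, $$\cfrac{1}{z+\cfrac{q/\delta}{z+\cfrac{q^2/\delta}{z+\cdots}}}=\frac1z\;\frac{{}_0\phi_1\left(\begin{matrix}-\\0\end{matrix};\frac{q^2}{\delta z^2}\right)}{{}_0\phi_1\left(\begin{matrix}-\\0\end{matrix};\frac{q}{\delta z^2}\right)},$$ where the $n$-th partial numerator ($n\ge1$) is $q^n/\delta$.
   Context: Notation: $(q)_k=\prod_{j=1}^k(1-q^j)$ and ${}_0\phi_1\left(\begin{matrix}-\\ 0\end{matrix};w\right)=\sum_{k\ge0}\frac{q^{k(k-1)}}{(q)_k}w^k$. *)

theory Defs
  imports Complex_Main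
begin

definition qfact :: "complex \<Rightarrow> nat \<Rightarrow> complex" where
  "qfact q k = (\<Prod>j=1..k. 1 - q ^ j)"

definition phi01 :: "complex \<Rightarrow> complex \<Rightarrow> complex" where
  "phi01 q w = (\<Sum>k. q ^ (k * (k - 1)) / qfact q k * w ^ k)"

text \<open>
  Continued fractions a 0 / (b 0 + a 1 / (b 1 + a 2 / (b 2 + ...))).  The n-th approximant
  (n levels kept, the rest replaced by 0) is the quotient of the canonical numerator and
  denominator given by the Wallis recurrences.  Evaluating the nested fraction directly would
  interact badly with x / 0 = 0: an inner denominator may vanish although the approximant,
  computed on the Riemann sphere, is finite.  Lemma cf_nested_eq shows that the two readings
  agree when no inner denominator vanishes.
\<close>

fun cf_num :: "(nat \<Rightarrow> complex) \<Rightarrow> (nat \<Rightarrow> complex) \<Rightarrow> nat \<Rightarrow> complex" where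
  "cf_num a b 0 = 0"
| "cf_num a b (Suc 0) = a 0"
| "cf_num a b (Suc (Suc n)) = b (Suc n) * cf_num a b (Suc n) + a (Suc n) * cf_num a b n"

fun cf_den :: "(nat \<Rightarrow> complex) \<Rightarrow> (nat \<Rightarrow> complex) \<Rightarrow> nat \<Rightarrow> complex" where
  "cf_den a b 0 = 1"
| "cf_den a b (Suc 0) = b 0"
| "cf_den a b (Suc (Suc n)) = b (Suc n) * cf_den a b (Suc n) + a (Suc n) * cf_den a b n"

text \<open>Convergence to a finite value; finitely many approximants may be infinite.\<close>

definition has_cf_value ::
    "(nat \<Rightarrow> complex) \<Rightarrow> (nat \<Rightarrow> complex) \<Rightarrow> complex \<Rightarrow> bool" where
  "has_cf_value a b L \<longleftrightarrow>
     (\<forall>\<^sub>F n in sequentially. cf_den a b n \<noteq> 0) \<and>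
     (\<lambda>n. cf_num a b n / cf_den a b n) \<longlonglongrightarrow> L"

primrec cf_nested :: "nat \<Rightarrow> (nat \<Rightarrow> complex) \<Rightarrow> (nat \<Rightarrow> complex) \<Rightarrow> complex" where
  "cf_nested 0 a b = 0"
| "cf_nested (Suc n) a b = a 0 / (b 0 + cf_nested n (\<lambda>i. a (Suc i)) (\<lambda>i. b (Suc i)))"

primrec cf_regular :: "nat \<Rightarrow> (nat \<Rightarrow> complex) \<Rightarrow> (nat \<Rightarrow> complex) \<Rightarrow> bool" where
  "cf_regular 0 a b \<longleftrightarrow> True"
| "cf_regular (Suc n) a b \<longleftrightarrow>
     b 0 + cf_nested n (\<lambda>i. a (Suc i)) (\<lambda>i. b (Suc i)) \<noteq> 0 \<and>
     cf_regular n (\<lambda>i. a (Suc i)) (\<lambda>i. b (Suc i))"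

lemma cf_num_shift: "cf_num a b (Suc n) = a 0 * cf_den (\<lambda>i. a (Suc i)) (\<lambda>i. b (Suc i)) n"
  by (induction n rule: induct_nat_012) (simp_all add: algebra_simps)

lemma cf_den_shift:
  "cf_den a b (Suc n) = b 0 * cf_den (\<lambda>i. a (Suc i)) (\<lambda>i. b (Suc i)) n
     + cf_num (\<lambda>i. a (Suc i)) (\<lambda>i. b (Suc i)) n"
  by (induction n rule: induct_nat_012) (simp_all add: algebra_simps)

lemma cf_nested_eq:
  assumes "cf_regular n a b"
  shows "cf_den a b n \<noteq> 0 \<and> cf_nested n a b = cf_num a b n / cf_den a b n"
  using assms
proof (induction n arbitrary: a b)
  case 0
  then show ?case by simp
next
  case (Suc n)
  let ?a = "\<lambda>i. a (Suc i)" and ?b = "\<lambda>i. b (Suc i)"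
  have IH: "cf_den ?a ?b n \<noteq> 0" "cf_nested n ?a ?b = cf_num ?a ?b n / cf_den ?a ?b n"
    using Suc.IH[of ?a ?b] Suc.prems by simp_all
  have eq: "b 0 + cf_nested n ?a ?b = cf_den a b (Suc n) / cf_den ?a ?b n"
    unfolding cf_den_shift IH(2) using IH(1) by (simp add: field_simps)
  have "cf_den a b (Suc n) \<noteq> 0"
    using Suc.prems eq by auto
  moreover have "cf_nested (Suc n) a b = cf_num a b (Suc n) / cf_den a b (Suc n)"
    unfolding cf_nested.simps eq cf_num_shift by simp
  ultimately show ?case by blast
qed

end

(* The series E(x) = phi01 q x satisfies E(x) = E(q x) + x E(q^2 x).  For b n = z, a n = c q^n and w = c / z^2, the denominators
   d n = cf_den a b n / z^n satisfy d (n+2) = d (n+1) + w q^(n+1) d n.  The two recurrences run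
   in opposite directions, so that d (n+1) E(q^(n+2) w) + w q^(n+1) d n E(q^(n+3) w) does not depend
   on n and equals E(q w).  Since d is bounded and E(q^n w) tends to 1, d n tends to E(q w).
   The numerators are the denominators of the shifted fraction, i.e. c is replaced by c q. *)
theory Submission
  imports Defs
begin

text \<open>The lower bound is uniform in \<open>k\<close>. It controls the ratios of consecutive
  terms of the series and keeps the factors of \<open>qfact\<close> away from zero.\<close>

lemma norm_one_minus_power_ge:
  fixes q :: complex
  assumes "norm q < 1"
  shows "1 - norm q \<le> norm (1 - q ^ Suc k)"
proof -
  have "norm (q ^ Suc k) \<le> norm q"
    using assms by (simp add: norm_mult norm_power mult_left_le power_le_one)
  moreover have "1 - norm (q ^ Suc k) \<le> norm (1 - q ^ Suc k)"
    using norm_triangle_ineq2[of 1 "q ^ Suc k"] by simp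
  ultimately show ?thesis by linarith
qed

definition phi01_coeff :: "complex \<Rightarrow> nat \<Rightarrow> complex" where
  "phi01_coeff q k = q ^ (k * (k - 1)) / qfact q k"

lemma phi01_powser: "phi01 q w = (\<Sum>k. phi01_coeff q k * w ^ k)"
  by (simp add: phi01_def phi01_coeff_def)

lemma phi01_coeff_0 [simp]: "phi01_coeff q 0 = 1"
  by (simp add: phi01_coeff_def qfact_def)

lemma phi01_coeff_Suc:
  "phi01_coeff q (Suc k) = phi01_coeff q k * (q ^ 2) ^ k / (1 - q ^ Suc k)"
proof -
  have "Suc k * (Suc k - 1) = k * (k - 1) + 2 * k"
    by (cases k) simp_all
  then have "q ^ (Suc k * (Suc k - 1)) = q ^ (k * (k - 1)) * (q ^ 2) ^ k"
    by (simp only: power_add power_mult)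
  moreover have "qfact q (Suc k) = qfact q k * (1 - q ^ Suc k)"
    by (simp add: qfact_def)
  ultimately show ?thesis
    by (simp only: phi01_coeff_def times_divide_eq_left divide_divide_eq_left)
qed

text \<open>The ratio of consecutive terms has norm at most
  \<open>norm (q ^ 2) ^ k * norm w / (1 - norm q)\<close>, which tends to 0. The series is therefore
  entire in \<open>w\<close>; 1/2 is just a convenient ratio below 1.\<close>

lemma summable_phi01:
  assumes "norm q < 1"
  shows "summable (\<lambda>k. phi01_coeff q k * w ^ k)"
proof -
  have "(\<lambda>k. norm (q ^ 2) ^ k * norm w / (1 - norm q)) \<longlonglongrightarrow> 0 * norm w / (1 - norm q)"
    using assms
    by (intro tendsto_intros LIMSEQ_power_zero) (simp_all add: norm_power power_less_one_iff)
  then have "\<forall>\<^sub>F k in sequentially. norm (q ^ 2) ^ k * norm w / (1 - norm q) < 1 / 2"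
    by (rule order_tendstoD(2)) simp
  then obtain N where N: "\<And>k. k \<ge> N \<Longrightarrow> norm (q ^ 2) ^ k * norm w / (1 - norm q) < 1 / 2"
    by (auto simp: eventually_sequentially)
  show ?thesis
  proof (rule summable_ratio_test[of "1 / 2" N])
    fix k assume "N \<le> k"
    have "norm (phi01_coeff q (Suc k) * w ^ Suc k)
        = norm (q ^ 2) ^ k * norm w / norm (1 - q ^ Suc k) * norm (phi01_coeff q k * w ^ k)"
      by (simp add: phi01_coeff_Suc norm_mult norm_divide norm_power)
    also have "\<dots> \<le> norm (q ^ 2) ^ k * norm w / (1 - norm q) * norm (phi01_coeff q k * w ^ k)"
      using assms norm_one_minus_power_ge[OF assms, of k]
      by (intro mult_right_mono divide_left_mono mult_pos_pos) auto
    also have "\<dots> \<le> 1 / 2 * norm (phi01_coeff q k * w ^ k)"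
      using N[OF \<open>N \<le> k\<close>] by (intro mult_right_mono) auto
    finally show "norm (phi01_coeff q (Suc k) * w ^ Suc k) \<le> 1 / 2 * norm (phi01_coeff q k * w ^ k)" .
  qed simp
qed

lemma phi01_0: "phi01 q 0 = 1"
  by (simp add: phi01_powser)

lemma isCont_phi01:
  assumes "norm q < 1"
  shows "isCont (phi01 q) w"
  using isCont_powser_converges_everywhere[of "phi01_coeff q" w] summable_phi01[OF assms]
  by (simp add: phi01_powser[abs_def])

text \<open>Compare coefficients: in \<open>phi01 q w - phi01 q (q * w)\<close> the constant terms
  cancel, and the factor \<open>1 - q ^ Suc k\<close> removes the last factor of
  \<open>qfact q (Suc k)\<close>. This leaves the coefficient of index \<open>k\<close> times
  \<open>(q ^ 2) ^ k\<close>.\<close>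

lemma phi01_recurrence:
  assumes "norm q < 1"
  shows "phi01 q w = phi01 q (q * w) + w * phi01 q (q ^ 2 * w)"
proof -
  let ?c = "phi01_coeff q"
  note s = summable_phi01[OF assms]
  have nz: "1 - q ^ Suc k \<noteq> 0" for k
    using norm_one_minus_power_ge[OF assms, of k] assms by auto
  have "?c (Suc k) * w ^ Suc k - ?c (Suc k) * (q * w) ^ Suc k = w * (?c k * (q ^ 2 * w) ^ k)" for k
  proof -
    have "?c (Suc k) * w ^ Suc k - ?c (Suc k) * (q * w) ^ Suc k
        = ?c (Suc k) * (1 - q ^ Suc k) * w ^ Suc k"
      by (simp only: power_mult_distrib) (simp add: algebra_simps)
    also have "?c (Suc k) * (1 - q ^ Suc k) = ?c k * (q ^ 2) ^ k"
      using nz[of k] by (simp add: phi01_coeff_Suc)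
    finally show ?thesis
      by (simp add: power_mult_distrib mult_ac)
  qed
  then have "w * phi01 q (q ^ 2 * w) = (\<Sum>k. ?c (Suc k) * w ^ Suc k - ?c (Suc k) * (q * w) ^ Suc k)"
    using suminf_mult[OF s, of w] by (simp add: phi01_powser)
  also have "\<dots> = phi01 q w - phi01 q (q * w)"
    using suminf_split_head[OF summable_diff[OF s s], of w "q * w"] suminf_diff[OF s s, of w "q * w"]
    by (simp add: phi01_powser)
  finally show ?thesis by simp
qed

text \<open>Each step enlarges the bound by a factor \<open>1 + norm w * norm q ^ Suc n\<close> at
  most, and the product of these factors is bounded because the geometric series converges.\<close>

lemma bounded_geometric_perturbation:
  fixes d :: "nat \<Rightarrow> complex"
  assumes "norm q < 1" and "\<And>n. d (Suc (Suc n)) = d (Suc n) + w * q ^ Suc n * d n"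
  shows "Bseq d"
proof -
  define S where "S n = norm w * (\<Sum>i<n. norm q ^ i)" for n
  define K where "K = max (norm (d 0)) (norm (d 1))"
  have S_Suc: "S (Suc n) = S n + norm w * norm q ^ n" for n
    by (simp add: S_def distrib_left)
  have mono: "exp (S n) \<le> exp (S (Suc n))" for n
    by (simp add: S_Suc)
  have K: "0 \<le> K" "norm (d 0) \<le> K" "norm (d 1) \<le> K"
    by (auto simp: K_def le_max_iff_disj)
  have S_nonneg: "0 \<le> S n" for n
    by (simp add: S_def sum_nonneg)
  \<comment> \<open>Two consecutive bounds are carried along because the recurrence has order
    two.\<close>
  have *: "norm (d n) \<le> K * exp (S n) \<and> norm (d (Suc n)) \<le> K * exp (S (Suc n))" for n
  proof (induction n)
    case 0
    have "K \<le> K * exp (S m)" for m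
      using K(1) S_nonneg[of m] by (simp add: mult_le_cancel_left1)
    then show ?case using K by (metis One_nat_def order_trans)
  next
    case (Suc n)
    let ?e = "norm w * norm q ^ Suc n"
    have "norm (d (Suc (Suc n))) \<le> norm (d (Suc n)) + ?e * norm (d n)"
      unfolding assms(2)
      by (rule order_trans[OF norm_triangle_ineq]) (simp add: norm_mult norm_power)
    also have "\<dots> \<le> K * exp (S (Suc n)) + ?e * (K * exp (S (Suc n)))"
      using Suc mono[of n] K(1)
      by (intro add_mono mult_left_mono) (auto intro: order_trans mult_left_mono)
    also have "\<dots> = K * exp (S (Suc n)) * (1 + ?e)"
      by (simp add: algebra_simps)
    \<comment> \<open>Here \<open>1 + x \<le> exp x\<close> turns the product of factors into the
      exponential of a sum; \<open>?e\<close> is exactly the next increment of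
      \<open>S\<close>.\<close>
    also have "\<dots> \<le> K * exp (S (Suc n)) * exp ?e"
      using K(1) by (intro mult_left_mono exp_ge_add_one_self) auto
    also have "\<dots> = K * exp (S (Suc (Suc n)))"
      by (simp only: S_Suc[of "Suc n"] exp_add mult.assoc)
    finally show ?case using Suc by blast
  qed
  have "norm (d n) \<le> K * exp (norm w * (1 / (1 - norm q)))" for n
  proof -
    have "(\<Sum>i<n. norm q ^ i) \<le> (\<Sum>i. norm q ^ i)"
      using assms(1) by (intro sum_le_suminf summable_geometric) auto
    also have "\<dots> = 1 / (1 - norm q)"
      using assms(1) by (intro suminf_geometric) simp
    finally have "exp (S n) \<le> exp (norm w * (1 / (1 - norm q)))"
      by (simp only: S_def exp_le_cancel_iff) (intro mult_left_mono, auto)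
    then show ?thesis
      using *[of n] K(1) by (meson mult_left_mono order_trans)
  qed
  then show ?thesis by (rule BseqI')
qed

lemma tendsto_phi01:
  fixes d :: "nat \<Rightarrow> complex"
  assumes q: "norm q < 1" and d0: "d 0 = 1" and d1: "d 1 = 1"
    and rec: "\<And>n. d (Suc (Suc n)) = d (Suc n) + w * q ^ Suc n * d n"
  shows "d \<longlonglongrightarrow> phi01 q (q * w)"
proof -
  define E where "E n = phi01 q (q ^ n * w)" for n
  have E_rec: "E n = E (Suc n) + q ^ n * w * E (Suc (Suc n))" for n
    using phi01_recurrence[OF q, of "q ^ n * w"] by (simp add: E_def power2_eq_square mult_ac)
  have inv: "d (Suc n) * E (Suc (Suc n)) + w * q ^ Suc n * d n * E (Suc (Suc (Suc n))) = E 1" for n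
  proof (induction n)
    case 0
    show ?case using E_rec[of 1] d0 d1 by (simp add: mult_ac)
  next
    case (Suc n)
    then show ?case
      \<comment> \<open>After expanding \<open>d (Suc (Suc n))\<close>, the terms with
        \<open>d (Suc n)\<close> combine to \<open>d (Suc n) * E (Suc (Suc n))\<close> by
        \<open>E_rec\<close>.\<close>
      using E_rec[of "Suc (Suc n)"] by (simp add: rec algebra_simps)
  qed
  have pow0: "(\<lambda>n. q ^ n) \<longlonglongrightarrow> 0"
    using q by (rule LIMSEQ_power_zero)
  have E_lim: "E \<longlonglongrightarrow> 1"
    using isCont_tendsto_compose[OF isCont_phi01[OF q] tendsto_mult_left_zero[OF pow0, of w]]
    by (simp add: E_def[abs_def] phi01_0)
  have E1: "(\<lambda>n. E (Suc (Suc n))) \<longlonglongrightarrow> 1" and E2: "(\<lambda>n. E (Suc (Suc (Suc n)))) \<longlonglongrightarrow> 1"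
    by (rule LIMSEQ_Suc E_lim)+
  have "Bseq d"
    using q rec by (rule bounded_geometric_perturbation)
  \<comment> \<open>A null sequence times a bounded one: the second term of the invariant disappears
    in the limit.\<close>
  then have "(\<lambda>n. q ^ Suc n * d n) \<longlonglongrightarrow> 0"
    using bounded_bilinear.Zfun_prod_Bfun[OF bounded_bilinear_mult] LIMSEQ_Suc[OF pow0]
    by (simp only: tendsto_Zfun_iff diff_0_right)
  then have "(\<lambda>n. w * (q ^ Suc n * d n) * E (Suc (Suc (Suc n)))) \<longlonglongrightarrow> w * 0 * 1"
    by (intro tendsto_mult tendsto_const E2)
  then have "(\<lambda>n. E 1 - w * (q ^ Suc n * d n) * E (Suc (Suc (Suc n)))) \<longlonglongrightarrow> E 1 - w * 0 * 1"
    by (intro tendsto_diff tendsto_const)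
  moreover have "E 1 - w * (q ^ Suc n * d n) * E (Suc (Suc (Suc n))) = d (Suc n) * E (Suc (Suc n))" for n
    using inv[of n] by (simp add: algebra_simps)
  ultimately have "(\<lambda>n. d (Suc n) * E (Suc (Suc n))) \<longlonglongrightarrow> E 1"
    by simp
  then have "(\<lambda>n. d (Suc n) * E (Suc (Suc n)) / E (Suc (Suc n))) \<longlonglongrightarrow> E 1 / 1"
    using E1 by (intro tendsto_divide) auto
  \<comment> \<open>Some \<open>E n\<close> may vanish, but only finitely many, since the limit is
    1.\<close>
  moreover have "\<forall>\<^sub>F n in sequentially. d (Suc n) * E (Suc (Suc n)) / E (Suc (Suc n)) = d (Suc n)"
    using tendsto_imp_eventually_ne[OF E1, of 0] by (auto elim: eventually_mono)
  ultimately have "(\<lambda>n. d (Suc n)) \<longlonglongrightarrow> E 1"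
    by (auto intro: Lim_transform_eventually)
  then show ?thesis
    by (simp add: filterlim_sequentially_Suc E_def)
qed

text \<open>Division by \<open>z ^ n\<close> normalizes the Wallis recurrence, with
  \<open>w = c / z ^ 2\<close>. Constraining \<open>a\<close> only from index 1 accommodates the
  leading partial numerator 1.\<close>

lemma tendsto_cf_den_phi01:
  fixes q c z :: complex
  assumes "norm q < 1" and "z \<noteq> 0" and a: "\<And>n. a (Suc n) = c * q ^ Suc n"
  shows "(\<lambda>n. cf_den a (\<lambda>_. z) n / z ^ n) \<longlonglongrightarrow> phi01 q (q * (c / z ^ 2))"
  using assms(1,2)
  by (intro tendsto_phi01) (simp_all add: a field_simps power2_eq_square)

theorem mainTheorem15:
  fixes q \<delta> z :: complex
  assumes "0 < norm q" and "norm q < 1"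
    and "\<delta> \<noteq> 0"
    and "z \<noteq> 0"
    and "phi01 q (q / (\<delta> * z ^ 2)) \<noteq> 0"
  shows "has_cf_value (\<lambda>n. if n = 0 then 1 else q ^ n / \<delta>) (\<lambda>n. z)
           (1 / z * (phi01 q (q ^ 2 / (\<delta> * z ^ 2)) / phi01 q (q / (\<delta> * z ^ 2))))"
proof -
  define a where "a = (\<lambda>n. if n = 0 then 1 else q ^ n / \<delta>)"
  define D where "D n = cf_den a (\<lambda>n. z) n / z ^ n" for n
  define N where "N n = cf_den (\<lambda>i. a (Suc i)) (\<lambda>n. z) n / z ^ n" for n
  have "D \<longlonglongrightarrow> phi01 q (q * (1 / \<delta> / z ^ 2))"
    unfolding D_def[abs_def] using assms(2,4)
    by (rule tendsto_cf_den_phi01) (simp add: a_def)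
  then have D_lim: "D \<longlonglongrightarrow> phi01 q (q / (\<delta> * z ^ 2))"
    by simp
  \<comment> \<open>For the shifted fraction,
    \<open>a (Suc (Suc n)) = (q / \<delta>) * q ^ Suc n\<close>, so \<open>c\<close> is
    \<open>q / \<delta>\<close> instead of \<open>1 / \<delta>\<close>.\<close>
  have "N \<longlonglongrightarrow> phi01 q (q * (q / \<delta> / z ^ 2))"
    unfolding N_def[abs_def] using assms(2,4)
    by (rule tendsto_cf_den_phi01) (simp add: a_def)
  then have N_lim: "N \<longlonglongrightarrow> phi01 q (q ^ 2 / (\<delta> * z ^ 2))"
    by (simp add: power2_eq_square)
  have "\<forall>\<^sub>F n in sequentially. cf_den a (\<lambda>n. z) n \<noteq> 0"
    using tendsto_imp_eventually_ne[OF D_lim assms(5)] by eventually_elim (auto simp: D_def)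
  moreover have "(\<lambda>n. cf_num a (\<lambda>n. z) n / cf_den a (\<lambda>n. z) n) \<longlonglongrightarrow>
      1 / z * (phi01 q (q ^ 2 / (\<delta> * z ^ 2)) / phi01 q (q / (\<delta> * z ^ 2)))"
  proof (rule LIMSEQ_imp_Suc)
    \<comment> \<open>With \<open>a 0 = 1\<close>, the numerator at \<open>Suc n\<close> is the
      shifted denominator at \<open>n\<close>. It is scaled by \<open>z ^ n\<close> against
      \<open>z ^ Suc n\<close> below, whence the factor \<open>1 / z\<close>.\<close>
    have "cf_num a (\<lambda>n. z) (Suc n) / cf_den a (\<lambda>n. z) (Suc n) = 1 / z * (N n / D (Suc n))" for n
      using assms(4) by (simp add: cf_num_shift N_def D_def a_def del: cf_den.simps)
    then show "(\<lambda>n. cf_num a (\<lambda>n. z) (Suc n) / cf_den a (\<lambda>n. z) (Suc n)) \<longlonglongrightarrow>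
        1 / z * (phi01 q (q ^ 2 / (\<delta> * z ^ 2)) / phi01 q (q / (\<delta> * z ^ 2)))"
      using N_lim LIMSEQ_Suc[OF D_lim] assms(5)
      by (simp only:) (intro tendsto_mult tendsto_divide tendsto_const)
  qed
  ultimately show ?thesis
    by (simp add: has_cf_value_def a_def)
qed

end
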